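(* Let $\varphi\colon F\rightarrowtail G$ be a monomorphism of groups. If $\varphi$ is not an isomorphism, then the functor $\bullet_{(\!(\varphi)\!)}\colon\mathsf{Ann}^G\to\mathsf{Ann}^F$ has no left adjoint and the functor $\bullet_{(\varphi)}\colon\mathsf{Ann}^G\to\mathsf{Ann}^F$ has no right adjoint.
   Context: Groups are commutative and written additively; rings are commutative with $1$. For a group $G$, a $G$-graded ring is a ring $R$ with a family $(R_g)_{g\in G}$ of additive subgroups whose direct sum is $R$ and with $R_gR_h\subseteq R_{g+h}$. Morphisms of $G$-graded rings are ring morphisms $u\colon R\to S$ with $u(R_g)\subseteq S_g$ for all $g$; this gives the category $\mathsf{Ann}^G$. Let $\varphi\colon F\rightarrowtail G$ be a monomorphism of groups. - $\varphi$-restriction $\bullet_{(\varphi)}$: for a $G$-graded ring $R$, $R_{(\varphi)}$ is the subring $\bigoplus_{f\in F}R_{\varphi(f)}$ of $R$ with the $F$-graduation $(R_{\varphi(f)})_{f\in F}$; morphisms are restricted. - $\varphi$-corestriction $\bullet_{(\!(\varphi)\!)}$: for a $G$-graded ring $R$, let $\mathfrak a_\varphi(R)$ be the (graded) ideal of $R$ generated by $\bigcup_{g\in G\setminus\mathrm{Im}(\varphi)}R_g$, and $R_{(\!(\varphi)\!)}:=(R/\mathfrak a_\varphi(R))_{(\varphi)}$; morphisms are the induced ones. *)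

theory Defs
  imports "HOL-Algebra.Generated_Groups" "HOL-Algebra.Weak_Morphisms" "HOL-Library.Countable_Set" "HOL-Library.Equipollence"
begin

section \<open>Categories, functors, adjoints\<close>

text \<open>
  A hom set is indexed by its source and target, and an element of \<open>'m\<close> need not
  determine them; hence \<open>cmp C X Y Z v u\<close>, the composite of \<open>u : X \<rightarrow> Y\<close> followed by
  \<open>v : Y \<rightarrow> Z\<close>, and the action of a functor on arrows carry the objects as arguments.
\<close>

record ('o, 'm) category =
  obj :: "'o set"
  arr :: "'o \<Rightarrow> 'o \<Rightarrow> 'm set"
  ident :: "'o \<Rightarrow> 'm"
  cmp :: "'o \<Rightarrow> 'o \<Rightarrow> 'o \<Rightarrow> 'm \<Rightarrow> 'm \<Rightarrow> 'm"

record ('o1, 'm1, 'o2, 'm2) cat_functor =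
  on_obj :: "'o1 \<Rightarrow> 'o2"
  on_arr :: "'o1 \<Rightarrow> 'o1 \<Rightarrow> 'm1 \<Rightarrow> 'm2"

definition is_functor ::
  "('o1, 'm1) category \<Rightarrow> ('o2, 'm2) category \<Rightarrow> ('o1, 'm1, 'o2, 'm2) cat_functor \<Rightarrow> bool"
  where
  "is_functor C D T \<longleftrightarrow>
    (\<forall>X \<in> obj C. on_obj T X \<in> obj D) \<and>
    (\<forall>X \<in> obj C. \<forall>Y \<in> obj C. \<forall>u \<in> arr C X Y.
       on_arr T X Y u \<in> arr D (on_obj T X) (on_obj T Y)) \<and>
    (\<forall>X \<in> obj C. on_arr T X X (ident C X) = ident D (on_obj T X)) \<and>
    (\<forall>X \<in> obj C. \<forall>Y \<in> obj C. \<forall>Z \<in> obj C. \<forall>u \<in> arr C X Y. \<forall>v \<in> arr C Y Z.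
       on_arr T X Z (cmp C X Y Z v u) =
       cmp D (on_obj T X) (on_obj T Y) (on_obj T Z) (on_arr T Y Z v) (on_arr T X Y u))"

text \<open>
  \<open>\<Phi> X Y : C(L X, Y) \<rightarrow> D(X, T Y)\<close> is a bijection, natural in \<open>X\<close> and \<open>Y\<close>; that is,
  \<open>L : D \<rightarrow> C\<close> is left adjoint to \<open>T : C \<rightarrow> D\<close>.
\<close>

definition adjunction ::
  "('o1, 'm1) category \<Rightarrow> ('o2, 'm2) category \<Rightarrow>
   ('o2, 'm2, 'o1, 'm1) cat_functor \<Rightarrow> ('o1, 'm1, 'o2, 'm2) cat_functor \<Rightarrow>
   ('o2 \<Rightarrow> 'o1 \<Rightarrow> 'm1 \<Rightarrow> 'm2) \<Rightarrow> bool"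
  where
  "adjunction C D L T \<Phi> \<longleftrightarrow>
    (\<forall>X \<in> obj D. \<forall>Y \<in> obj C.
       bij_betw (\<Phi> X Y) (arr C (on_obj L X) Y) (arr D X (on_obj T Y))) \<and>
    (\<forall>X \<in> obj D. \<forall>X' \<in> obj D. \<forall>Y \<in> obj C. \<forall>a \<in> arr D X' X. \<forall>u \<in> arr C (on_obj L X) Y.
       \<Phi> X' Y (cmp C (on_obj L X') (on_obj L X) Y u (on_arr L X' X a)) =
       cmp D X' X (on_obj T Y) (\<Phi> X Y u) a) \<and>
    (\<forall>X \<in> obj D. \<forall>Y \<in> obj C. \<forall>Y' \<in> obj C. \<forall>v \<in> arr C Y Y'. \<forall>u \<in> arr C (on_obj L X) Y.
       \<Phi> X Y' (cmp C (on_obj L X) Y Y' v u) =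
       cmp D X (on_obj T Y) (on_obj T Y') (on_arr T Y Y' v) (\<Phi> X Y u))"

definition has_left_adjoint ::
  "('o1, 'm1) category \<Rightarrow> ('o2, 'm2) category \<Rightarrow> ('o1, 'm1, 'o2, 'm2) cat_functor \<Rightarrow> bool"
  where
  "has_left_adjoint C D T \<longleftrightarrow> (\<exists>L \<Phi>. is_functor D C L \<and> adjunction C D L T \<Phi>)"

definition has_right_adjoint ::
  "('o1, 'm1) category \<Rightarrow> ('o2, 'm2) category \<Rightarrow> ('o1, 'm1, 'o2, 'm2) cat_functor \<Rightarrow> bool"
  where
  "has_right_adjoint C D T \<longleftrightarrow> (\<exists>S \<Phi>. is_functor D C S \<and> adjunction D C T S \<Phi>)"


section \<open>Graded rings\<close>

text \<open>
  The grading group is a commutative group in the sense of HOL-Algebra, so its operation is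
  written multiplicatively.
\<close>

record ('a, 'g) graded_ring = "'a ring" +
  component :: "'g \<Rightarrow> 'a set"

definition is_graded_ring :: "('g, 'x) monoid_scheme \<Rightarrow> ('a, 'g) graded_ring \<Rightarrow> bool" where
  "is_graded_ring G R \<longleftrightarrow>
    cring R \<and>
    (\<forall>g \<in> carrier G. additive_subgroup (component R g) R) \<and>
    (\<forall>r \<in> carrier R. \<exists>!x. x \<in> (\<Pi>\<^sub>E g \<in> carrier G. component R g) \<and>
       finite {g \<in> carrier G. x g \<noteq> \<zero>\<^bsub>R\<^esub>} \<and>
       r = (\<Oplus>\<^bsub>R\<^esub> g \<in> {g \<in> carrier G. x g \<noteq> \<zero>\<^bsub>R\<^esub>}. x g)) \<and>
    (\<forall>g \<in> carrier G. \<forall>h \<in> carrier G. \<forall>r \<in> component R g. \<forall>s \<in> component R h.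
       r \<otimes>\<^bsub>R\<^esub> s \<in> component R (g \<otimes>\<^bsub>G\<^esub> h))"

definition graded_hom ::
  "('g, 'x) monoid_scheme \<Rightarrow> ('a, 'g) graded_ring \<Rightarrow> ('b, 'g) graded_ring \<Rightarrow> ('a \<Rightarrow> 'b) set"
  where
  "graded_hom G R S =
    {u \<in> ring_hom R S. u \<in> extensional (carrier R) \<and>
       (\<forall>g \<in> carrier G. u ` component R g \<subseteq> component S g)}"

text \<open>
  The type \<open>'a\<close> plays the role of the universe: the objects are the graded rings carried by
  subsets of \<open>'a\<close> of cardinality strictly below that of \<open>'a\<close>.  If that cardinality is
  inaccessible, this is, up to equivalence, the category of graded rings in a Grothendieck
  universe.
\<close>

definition Ann ::
  "'a itself \<Rightarrow> ('g, 'x) monoid_scheme \<Rightarrow> (('a, 'g) graded_ring, 'a \<Rightarrow> 'a) category" where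
  "Ann U G =
    \<lparr> obj = {R. is_graded_ring G R \<and> carrier R \<prec> (UNIV :: 'a set)},
      arr = graded_hom G,
      ident = (\<lambda>R. restrict id (carrier R)),
      cmp = (\<lambda>R S T v u. compose (carrier R) v u) \<rparr>"


section \<open>Restriction\<close>

definition restricted_ring ::
  "('f, 'x) monoid_scheme \<Rightarrow> ('f \<Rightarrow> 'g) \<Rightarrow> ('a, 'g) graded_ring \<Rightarrow> ('a, 'f) graded_ring" where
  "restricted_ring F \<phi> R =
    ring.extend
      ((ring.truncate R)
        \<lparr>carrier := generate (add_monoid R) (\<Union>f \<in> carrier F. component R (\<phi> f))\<rparr>)
      (graded_ring.fields (\<lambda>f. component R (\<phi> f)))"

definition restriction ::
  "('f, 'x) monoid_scheme \<Rightarrow> ('f \<Rightarrow> 'g) \<Rightarrow>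
   (('a, 'g) graded_ring, 'a \<Rightarrow> 'a, ('a, 'f) graded_ring, 'a \<Rightarrow> 'a) cat_functor" where
  "restriction F \<phi> =
    \<lparr> on_obj = restricted_ring F \<phi>,
      on_arr = (\<lambda>R S u. restrict u (carrier (restricted_ring F \<phi> R))) \<rparr>"


section \<open>Corestriction\<close>

definition corestriction_ideal ::
  "('f, 'x) monoid_scheme \<Rightarrow> ('g, 'y) monoid_scheme \<Rightarrow> ('f \<Rightarrow> 'g) \<Rightarrow> ('a, 'g) graded_ring \<Rightarrow> 'a set"
  where
  "corestriction_ideal F G \<phi> R =
    Idl\<^bsub>R\<^esub> (\<Union>g \<in> carrier G - \<phi> ` carrier F. component R g)"

definition quotient_graded_ring ::
  "('a, 'g) graded_ring \<Rightarrow> 'a set \<Rightarrow> ('a set, 'g) graded_ring" where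
  "quotient_graded_ring R I =
    ring.extend (R Quot I) (graded_ring.fields (\<lambda>g. (\<lambda>r. I +>\<^bsub>R\<^esub> r) ` component R g))"

definition corestricted_ring ::
  "('f, 'x) monoid_scheme \<Rightarrow> ('g, 'y) monoid_scheme \<Rightarrow> ('f \<Rightarrow> 'g) \<Rightarrow>
   ('a, 'g) graded_ring \<Rightarrow> ('a set, 'f) graded_ring" where
  "corestricted_ring F G \<phi> R =
    restricted_ring F \<phi> (quotient_graded_ring R (corestriction_ideal F G \<phi> R))"

text \<open>
  The induced map: the union below is over the representatives \<open>r\<close> of the class \<open>K\<close>, and all
  of them contribute the same class.
\<close>

definition corestricted_map ::
  "('f, 'x) monoid_scheme \<Rightarrow> ('g, 'y) monoid_scheme \<Rightarrow> ('f \<Rightarrow> 'g) \<Rightarrow>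
   ('a, 'g) graded_ring \<Rightarrow> ('a, 'g) graded_ring \<Rightarrow> ('a \<Rightarrow> 'a) \<Rightarrow> 'a set \<Rightarrow> 'a set" where
  "corestricted_map F G \<phi> R S u =
    (\<lambda>K \<in> carrier (corestricted_ring F G \<phi> R).
       \<Union>r \<in> K. corestriction_ideal F G \<phi> S +>\<^bsub>S\<^esub> u r)"

text \<open>
  The elements of \<open>corestricted_ring\<close> are cosets, of type \<open>'a set\<close>.  To obtain a functor with
  values in graded rings over \<open>'a\<close>, the structure is transported along the injection sending
  a coset to a chosen element of it.
\<close>

definition coset_rep :: "'a set \<Rightarrow> 'a" where
  "coset_rep K = (SOME r. r \<in> K)"

definition transport_ring :: "('a \<Rightarrow> 'b) \<Rightarrow> ('a, 'g) graded_ring \<Rightarrow> ('b, 'g) graded_ring" where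
  "transport_ring i R =
    ring.extend (image_ring i R) (graded_ring.fields (\<lambda>g. i ` component R g))"

definition transport_map ::
  "('a \<Rightarrow> 'b) \<Rightarrow> ('a, 'g) graded_ring \<Rightarrow> ('a \<Rightarrow> 'a) \<Rightarrow> 'b \<Rightarrow> 'b" where
  "transport_map i R u = (\<lambda>y \<in> i ` carrier R. i (u (inv_into (carrier R) i y)))"

definition corestriction ::
  "('f, 'x) monoid_scheme \<Rightarrow> ('g, 'y) monoid_scheme \<Rightarrow> ('f \<Rightarrow> 'g) \<Rightarrow>
   (('a, 'g) graded_ring, 'a \<Rightarrow> 'a, ('a, 'f) graded_ring, 'a \<Rightarrow> 'a) cat_functor" where
  "corestriction F G \<phi> =
    \<lparr> on_obj = (\<lambda>R. transport_ring coset_rep (corestricted_ring F G \<phi> R)),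
      on_arr = (\<lambda>R S u.
        transport_map coset_rep (corestricted_ring F G \<phi> R) (corestricted_map F G \<phi> R S u)) \<rparr>"

end

theory Submission
  imports Defs "HOL-Library.Poly_Mapping"
begin

text \<open>
  Fix \<open>g\<close> in \<open>G\<close> outside the image of \<open>\<phi>\<close>.  Each of the two claims is refuted on one explicit
  graded ring containing elements of degree \<open>g\<close> and \<open>- g\<close> that multiply to a nonzero element of
  degree \<open>0\<close>.

  \<^emph>\<open>Corestriction.\<close>  Suppose that \<open>L\<close> is left adjoint to corestriction, and let \<open>M = L 0\<close> be the
  image of the zero ring.  The zero ring has at most one morphism to any ring, and it has one to the
  corestriction of \<open>Y\<close> exactly if that corestriction vanishes, that is, if \<open>1 \<in> \<aa>\<^sub>\<phi>(Y)\<close>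
  (\<open>zero_ring_hom_imp_one_in_ideal\<close>, \<open>one_in_ideal_imp_zero_ring_hom\<close>).  So there is at most one
  morphism \<open>M \<rightarrow> Y\<close>, and there is one if and only if \<open>1 \<in> \<aa>\<^sub>\<phi>(Y)\<close>.  The identity of \<open>M\<close> shows
  \<open>1 \<in> \<aa>\<^sub>\<phi>(M)\<close>.  In \<open>S = \<rat>[x, x\<^bsup>-1\<^esup>]\<close> with \<open>x\<close> of degree \<open>g\<close>, the ideal \<open>\<aa>\<^sub>\<phi>(S)\<close> contains the unit
  \<open>x\<close>, so there is a unique morphism \<open>f : M \<rightarrow> S\<close>.  By uniqueness it is fixed by the graded
  automorphism \<open>x \<mapsto> 2 x\<close>, whose fixed ring is \<open>\<rat>\<close>.  Hence \<open>f\<close> has image in degree \<open>0\<close> and kills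
  every component of degree outside the image of \<open>\<phi>\<close>, so it kills \<open>\<aa>\<^sub>\<phi>(M)\<close>, which contains \<open>1\<close>.
  This contradicts \<open>S \<noteq> 0\<close>.

  \<^emph>\<open>Restriction.\<close>  Suppose that \<open>D\<close> is right adjoint to restriction.  Let
  \<open>P = \<int>[x, y] / (x\<^sup>2, y\<^sup>2)\<close> with \<open>x\<close> of degree \<open>g\<close> and \<open>y\<close> of degree \<open>- g\<close>.  Its restriction is
  \<open>N = \<int> \<oplus> \<int> x y\<close>, of degree \<open>0\<close>.  The substitution \<open>E p q : x \<mapsto> p x, y \<mapsto> q y\<close> is a graded
  endomorphism of \<open>P\<close>, and its restriction to \<open>N\<close> depends only on \<open>p q\<close>.  Let \<open>Y\<close> be the ring \<open>P\<close>
  put entirely in degree \<open>0\<close>, and let \<open>f : P \<rightarrow> D Y\<close> correspond to the inclusion \<open>N \<rightarrow> Y\<close>.  By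
  naturality \<open>f \<circ> E p q\<close> depends only on \<open>p q\<close>.  Comparing \<open>E 0 1\<close> with \<open>E 0 0\<close> gives \<open>f y = 0\<close>;
  therefore \<open>f \<circ> E 1 0 = f\<close>, and transposing back, the inclusion \<open>N \<rightarrow> Y\<close> is unchanged by
  \<open>x y \<mapsto> 0\<close>, which is absurd.

  Both rings are \<open>\<int>\<close>-graded; the \<open>G\<close>-graduation is the coarsening along \<open>n \<mapsto> n g\<close>, which makes sense
  whatever the order of \<open>g\<close>.  Both are countable, so that an uncountable type \<open>'a\<close> holds a copy of
  each of them that is an object of the category.
\<close>

section \<open>Coarsening an integer grading\<close>

text \<open>
  A \<open>\<int>\<close>-grading of a ring given by its projections: in this form the homogeneous parts of an
  element are available by evaluation, and two elements are equal as soon as all their parts are.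
\<close>

locale int_grading =
  fixes \<pi> :: "int \<Rightarrow> 'b::comm_ring_1 \<Rightarrow> 'b"
  assumes proj_add: "\<pi> n (r + s) = \<pi> n r + \<pi> n s"
    and proj_proj: "\<pi> m (\<pi> n r) = (if m = n then \<pi> n r else 0)"
    and finite_support: "finite {n. \<pi> n r \<noteq> 0}"
    and sum_proj: "(\<Sum>n | \<pi> n r \<noteq> 0. \<pi> n r) = r"
    and proj_mult: "\<pi> (m + n) (\<pi> m r * \<pi> n s) = \<pi> m r * \<pi> n s"
begin

lemma proj_0 [simp]: "\<pi> n 0 = 0"
  using proj_add[of n 0 0] by simp

lemma proj_minus: "\<pi> n (- r) = - \<pi> n r"
  using proj_add[of n r "- r"] by (simp add: eq_neg_iff_add_eq_0 add.commute)

lemma proj_sum: "\<pi> n (sum f A) = (\<Sum>a\<in>A. \<pi> n (f a))"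
  by (induction A rule: infinite_finite_induct) (auto simp: proj_add)

lemma proj_eqI: "(\<And>n. \<pi> n r = \<pi> n s) \<Longrightarrow> r = s"
  by (metis (no_types, lifting) sum_proj Collect_cong sum.cong)

end

text \<open>
  The component of degree \<open>h\<close> of the grading by \<open>G\<close> obtained from the integer grading \<open>\<pi>\<close> along
  \<open>n \<mapsto> g\<^sup>n\<close>.  For \<open>g = \<one>\<close> everything is in degree \<open>\<one>\<close>.
\<close>

definition coarsening ::
  "(int \<Rightarrow> 'b \<Rightarrow> 'b::zero) \<Rightarrow> ('g, 'x) monoid_scheme \<Rightarrow> 'g \<Rightarrow> 'g \<Rightarrow> 'b set" where
  "coarsening \<pi> G g h = {r. \<forall>n. \<pi> n r \<noteq> 0 \<longrightarrow> g [^]\<^bsub>G\<^esub> n = h}"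

context int_grading
begin

lemma coarsening_0: "0 \<in> coarsening \<pi> G g h"
  by (simp add: coarsening_def)

lemma coarsening_add:
  "r \<in> coarsening \<pi> G g h \<Longrightarrow> s \<in> coarsening \<pi> G g h \<Longrightarrow> r + s \<in> coarsening \<pi> G g h"
  unfolding coarsening_def proj_add mem_Collect_eq by (metis add_0)

lemma coarsening_minus: "r \<in> coarsening \<pi> G g h \<Longrightarrow> - r \<in> coarsening \<pi> G g h"
  by (simp add: coarsening_def proj_minus)

lemma coarsening_sum:
  "(\<And>a. a \<in> A \<Longrightarrow> f a \<in> coarsening \<pi> G g h) \<Longrightarrow> sum f A \<in> coarsening \<pi> G g h"
  by (induction A rule: infinite_finite_induct) (auto intro: coarsening_0 coarsening_add)

lemma coarsening_mult:
  assumes "group G" and g: "g \<in> carrier G"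
    and r: "r \<in> coarsening \<pi> G g h" and s: "s \<in> coarsening \<pi> G g k"
  shows "r * s \<in> coarsening \<pi> G g (h \<otimes>\<^bsub>G\<^esub> k)"
proof -
  have "\<pi> m r * \<pi> n s \<in> coarsening \<pi> G g (h \<otimes>\<^bsub>G\<^esub> k)"
    if "\<pi> m r \<noteq> 0" "\<pi> n s \<noteq> 0" for m n
  proof -
    have "g [^]\<^bsub>G\<^esub> (m + n) = h \<otimes>\<^bsub>G\<^esub> k"
      using that r s group.int_pow_mult[OF assms(1) g] by (simp add: coarsening_def)
    moreover have "l = m + n" if "\<pi> l (\<pi> m r * \<pi> n s) \<noteq> 0" for l
      using that proj_proj[of l "m + n" "\<pi> m r * \<pi> n s"] unfolding proj_mult by metis
    ultimately show ?thesis
      by (auto simp: coarsening_def)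
  qed
  then have "(\<Sum>m | \<pi> m r \<noteq> 0. \<Sum>n | \<pi> n s \<noteq> 0. \<pi> m r * \<pi> n s)
      \<in> coarsening \<pi> G g (h \<otimes>\<^bsub>G\<^esub> k)"
    by (intro coarsening_sum) auto
  then show ?thesis
    by (simp add: sum_product[symmetric] sum_proj)
qed

definition part :: "('g, 'x) monoid_scheme \<Rightarrow> 'g \<Rightarrow> 'g \<Rightarrow> 'b \<Rightarrow> 'b" where
  "part G g h r = (\<Sum>n | \<pi> n r \<noteq> 0 \<and> g [^]\<^bsub>G\<^esub> n = h. \<pi> n r)"

lemma proj_part: "\<pi> n (part G g h r) = (if g [^]\<^bsub>G\<^esub> n = h then \<pi> n r else 0)"
proof -
  have "finite {n. \<pi> n r \<noteq> 0 \<and> g [^]\<^bsub>G\<^esub> n = h}"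
    by (rule finite_subset[OF _ finite_support[of r]]) auto
  then show ?thesis
    by (auto simp: part_def proj_sum proj_proj)
qed

lemma part_in_coarsening: "part G g h r \<in> coarsening \<pi> G g h"
  by (simp add: coarsening_def proj_part)

lemma part_nonzero:
  assumes "part G g h r \<noteq> 0" obtains n where "\<pi> n r \<noteq> 0" "g [^]\<^bsub>G\<^esub> n = h"
  using assms unfolding part_def by (auto elim!: sum.not_neutral_contains_not_neutral)

lemma finite_parts: "finite {h \<in> carrier G. part G g h r \<noteq> 0}"
  by (rule finite_subset[OF _ finite_imageI[OF finite_support[of r], of "\<lambda>n. g [^]\<^bsub>G\<^esub> n"]])
    (auto elim: part_nonzero)

lemma sum_parts:
  assumes "group G" and g: "g \<in> carrier G"
  shows "(\<Sum>h | h \<in> carrier G \<and> part G g h r \<noteq> 0. part G g h r) = r"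
proof (rule proj_eqI)
  fix n :: int
  have "g [^]\<^bsub>G\<^esub> n \<in> carrier G"
    using group.int_pow_closed[OF assms] by blast
  moreover have "\<pi> n r = 0" if "part G g (g [^]\<^bsub>G\<^esub> n) r = 0"
    using proj_part[of n G g "g [^]\<^bsub>G\<^esub> n" r] that by simp
  ultimately show "\<pi> n (\<Sum>h | h \<in> carrier G \<and> part G g h r \<noteq> 0. part G g h r) = \<pi> n r"
    using finite_parts[of G g r] by (auto simp: proj_sum proj_part)
qed

text \<open>
  Apply \<open>\<pi> n\<close> to the sum: the only summand that can contribute is the one of degree \<open>g\<^sup>n\<close>.
\<close>

lemma part_unique:
  assumes "group G" and g: "g \<in> carrier G"
    and y: "\<And>h. h \<in> carrier G \<Longrightarrow> y h \<in> coarsening \<pi> G g h"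
    and fin: "finite {h \<in> carrier G. y h \<noteq> 0}"
    and h: "h \<in> carrier G"
  shows "y h = part G g h (\<Sum>h | h \<in> carrier G \<and> y h \<noteq> 0. y h)"
proof (rule proj_eqI)
  fix n :: int
  let ?k = "g [^]\<^bsub>G\<^esub> n"
  have k: "?k \<in> carrier G"
    using group.int_pow_closed[OF assms(1,2)] by blast
  have y0: "\<pi> n (y h') = 0" if "h' \<in> carrier G" "h' \<noteq> ?k" for h'
    using y[OF that(1)] that by (auto simp: coarsening_def)
  have "\<pi> n (\<Sum>h | h \<in> carrier G \<and> y h \<noteq> 0. y h)
      = (\<Sum>h | h \<in> carrier G \<and> y h \<noteq> 0. if h = ?k then \<pi> n (y ?k) else 0)"
    unfolding proj_sum by (rule sum.cong) (auto simp: y0)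
  also have "\<dots> = \<pi> n (y ?k)"
    using fin k by auto
  finally show "\<pi> n (y h) = \<pi> n (part G g h (\<Sum>h | h \<in> carrier G \<and> y h \<noteq> 0. y h))"
    using y0[OF h] by (auto simp: proj_part)
qed

end

section \<open>Copies of graded rings inside a large type\<close>

text \<open>
  The coarsened grading, transported along an injection \<open>i\<close> from the type of the ring into the
  type \<open>'a\<close> that plays the role of the universe.
\<close>

definition graded_copy ::
  "('b::comm_ring_1 \<Rightarrow> 'a) \<Rightarrow> (int \<Rightarrow> 'b \<Rightarrow> 'b) \<Rightarrow> ('g, 'x) monoid_scheme \<Rightarrow> 'g \<Rightarrow>
   ('a, 'g) graded_ring" where
  "graded_copy i \<pi> G g =
    \<lparr> carrier = range i,
      mult = (\<lambda>a b. i (inv_into UNIV i a * inv_into UNIV i b)),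
      one = i 1,
      zero = i 0,
      add = (\<lambda>a b. i (inv_into UNIV i a + inv_into UNIV i b)),
      component = (\<lambda>h. i ` coarsening \<pi> G g h) \<rparr>"

lemma graded_copy_sel:
  "carrier (graded_copy i \<pi> G g) = range i"
  "mult (graded_copy i \<pi> G g) = (\<lambda>a b. i (inv_into UNIV i a * inv_into UNIV i b))"
  "one (graded_copy i \<pi> G g) = i 1"
  "zero (graded_copy i \<pi> G g) = i 0"
  "add (graded_copy i \<pi> G g) = (\<lambda>a b. i (inv_into UNIV i a + inv_into UNIV i b))"
  "component (graded_copy i \<pi> G g) h = i ` coarsening \<pi> G g h"
  by (simp_all add: graded_copy_def)

lemma cring_graded_copy:
  assumes "inj i"
  shows "cring (graded_copy i \<pi> G g)"
proof (rule cringI)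
  show "abelian_group (graded_copy i \<pi> G g)"
  proof (rule abelian_groupI)
    fix x assume "x \<in> carrier (graded_copy i \<pi> G g)"
    then obtain r where "x = i r" by (auto simp: graded_copy_sel)
    then show "\<exists>y\<in>carrier (graded_copy i \<pi> G g).
        y \<oplus>\<^bsub>graded_copy i \<pi> G g\<^esub> x = \<zero>\<^bsub>graded_copy i \<pi> G g\<^esub>"
      using assms by (auto simp: graded_copy_sel intro!: exI[of _ "- r"])
  qed (use assms in \<open>auto simp: graded_copy_sel algebra_simps\<close>)
  show "Group.comm_monoid (graded_copy i \<pi> G g)"
    by (rule comm_monoidI) (use assms in \<open>auto simp: graded_copy_sel algebra_simps\<close>)
qed (use assms in \<open>auto simp: graded_copy_sel algebra_simps\<close>)

lemma finsum_graded_copy: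
  assumes "inj i" and "finite A" and "\<And>a. a \<in> A \<Longrightarrow> x a = i (f a)"
  shows "finsum (graded_copy i \<pi> G g) x A = i (sum f A)"
proof -
  interpret cring "graded_copy i \<pi> G g"
    by (rule cring_graded_copy[OF assms(1)])
  show ?thesis
    using assms(2,3)
  proof (induction A)
    case (insert a A)
    have "finsum (graded_copy i \<pi> G g) x (insert a A)
        = x a \<oplus>\<^bsub>graded_copy i \<pi> G g\<^esub> finsum (graded_copy i \<pi> G g) x A"
      using insert by (intro finsum_insert) (auto simp: graded_copy_sel)
    then show ?case
      using insert assms(1) by (simp add: graded_copy_sel)
  qed (simp add: graded_copy_sel)
qed

lemma (in int_grading) is_graded_ring_graded_copy:
  assumes i: "inj i" and G: "group G" and g: "g \<in> carrier G"
  shows "is_graded_ring G (graded_copy i \<pi> G g)" (is "is_graded_ring G ?R")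
proof -
  interpret R: cring ?R
    by (rule cring_graded_copy[OF i])
  have "additive_subgroup (component ?R h) ?R" for h
  proof (rule additive_subgroup.intro, rule R.add.subgroupI)
    show "component ?R h \<subseteq> carrier ?R"
      by (auto simp: graded_copy_sel)
    show "component ?R h \<noteq> {}"
      using coarsening_0[of G g h] by (auto simp: graded_copy_sel)
    fix a assume "a \<in> component ?R h"
    then obtain r where r: "a = i r" "r \<in> coarsening \<pi> G g h" by (auto simp: graded_copy_sel)
    have "\<ominus>\<^bsub>?R\<^esub> a = i (- r)"
      using i r by (intro R.minus_equality) (auto simp: graded_copy_sel)
    then show "\<ominus>\<^bsub>?R\<^esub> a \<in> component ?R h"
      using coarsening_minus[OF r(2)] by (simp add: graded_copy_sel)
    fix b assume "b \<in> component ?R h"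
    then show "a \<oplus>\<^bsub>?R\<^esub> b \<in> component ?R h"
      using i r by (auto simp: graded_copy_sel intro!: imageI coarsening_add)
  qed
  moreover have "\<exists>!x. x \<in> (\<Pi>\<^sub>E h \<in> carrier G. component ?R h) \<and>
       finite {h \<in> carrier G. x h \<noteq> \<zero>\<^bsub>?R\<^esub>} \<and>
       a = (\<Oplus>\<^bsub>?R\<^esub> h \<in> {h \<in> carrier G. x h \<noteq> \<zero>\<^bsub>?R\<^esub>}. x h)"
    if a: "a \<in> carrier ?R" for a
  proof -
    obtain r where r: "a = i r" using a by (auto simp: graded_copy_sel)
    let ?x = "\<lambda>h\<in>carrier G. i (part G g h r)"
    show ?thesis
    proof (rule ex1I[of _ ?x], intro conjI)
      show "?x \<in> (\<Pi>\<^sub>E h \<in> carrier G. component ?R h)"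
        by (auto simp: graded_copy_sel intro!: imageI part_in_coarsening)
      have supp: "{h \<in> carrier G. ?x h \<noteq> \<zero>\<^bsub>?R\<^esub>} = {h \<in> carrier G. part G g h r \<noteq> 0}"
        using i by (auto simp: graded_copy_sel inj_eq)
      show "finite {h \<in> carrier G. ?x h \<noteq> \<zero>\<^bsub>?R\<^esub>}"
        unfolding supp by (rule finite_parts)
      show "a = (\<Oplus>\<^bsub>?R\<^esub> h \<in> {h \<in> carrier G. ?x h \<noteq> \<zero>\<^bsub>?R\<^esub>}. ?x h)"
        unfolding supp r
        by (subst finsum_graded_copy[OF i finite_parts, where f = "\<lambda>h. part G g h r"])
          (auto simp: sum_parts[OF G g])
    next
      fix x
      assume x: "x \<in> (\<Pi>\<^sub>E h \<in> carrier G. component ?R h) \<and>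
         finite {h \<in> carrier G. x h \<noteq> \<zero>\<^bsub>?R\<^esub>} \<and>
         a = (\<Oplus>\<^bsub>?R\<^esub> h \<in> {h \<in> carrier G. x h \<noteq> \<zero>\<^bsub>?R\<^esub>}. x h)"
      define y where "y h = inv_into UNIV i (x h)" for h
      have y: "x h = i (y h) \<and> y h \<in> coarsening \<pi> G g h" if "h \<in> carrier G" for h
      proof -
        have "x h \<in> i ` coarsening \<pi> G g h"
          using x that by (auto simp: graded_copy_sel)
        then show ?thesis
          using i by (auto simp: y_def)
      qed
      have supp: "{h \<in> carrier G. x h \<noteq> \<zero>\<^bsub>?R\<^esub>} = {h \<in> carrier G. y h \<noteq> 0}"
        using i y by (auto simp: graded_copy_sel inj_eq)
      have fin: "finite {h \<in> carrier G. y h \<noteq> 0}"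
        using x supp by simp
      have "i r = (\<Oplus>\<^bsub>?R\<^esub> h \<in> {h \<in> carrier G. y h \<noteq> 0}. x h)"
        using x r supp by simp
      also have "\<dots> = i (\<Sum>h | h \<in> carrier G \<and> y h \<noteq> 0. y h)"
        using y by (intro finsum_graded_copy[OF i fin]) auto
      finally have r': "r = (\<Sum>h | h \<in> carrier G \<and> y h \<noteq> 0. y h)"
        using i by (simp add: inj_eq)
      show "x = ?x"
      proof (rule PiE_ext)
        show "x \<in> (\<Pi>\<^sub>E h \<in> carrier G. component ?R h)" using x by blast
        show "?x \<in> (\<Pi>\<^sub>E h \<in> carrier G. component ?R h)"
          by (auto simp: graded_copy_sel intro!: imageI part_in_coarsening)
        show "x h = ?x h" if "h \<in> carrier G" for h
          using y[OF that] part_unique[OF G g _ fin that] y that by (simp add: r')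
      qed
    qed
  qed
  moreover have "a \<otimes>\<^bsub>?R\<^esub> b \<in> component ?R (h \<otimes>\<^bsub>G\<^esub> k)"
    if "a \<in> component ?R h" "b \<in> component ?R k" for a b h k
    using that i by (auto simp: graded_copy_sel intro!: imageI coarsening_mult[OF G g])
  ultimately show ?thesis
    unfolding is_graded_ring_def using R.is_cring by blast
qed

lemma countable_range_lesspoll:
  fixes i :: "'b \<Rightarrow> 'a"
  assumes "uncountable (UNIV :: 'a set)" and "countable (UNIV :: 'b set)"
  shows "range i \<prec> (UNIV :: 'a set)"
proof -
  have "countable (range i)"
    using assms(2) by (rule countable_image)
  then have "\<not> range i \<approx> (UNIV :: 'a set)"
    using assms(1) countable_eqpoll eqpoll_sym by blast
  moreover have "range i \<lesssim> (UNIV :: 'a set)"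
    by (rule subset_imp_lepoll) (rule subset_UNIV)
  ultimately show ?thesis
    unfolding lesspoll_def by (rule conjI[rotated])
qed

lemma obtain_injection:
  assumes "uncountable (UNIV :: 'a set)" and "countable (UNIV :: 'b set)"
  obtains i :: "'b \<Rightarrow> 'a" where "inj i"
proof -
  obtain f :: "nat \<Rightarrow> 'a" where "inj f"
    using infinite_countable_subset[OF uncountable_infinite[OF assms(1)]] by auto
  moreover have "inj (to_nat_on (UNIV :: 'b set))"
    by (rule inj_on_to_nat_on) (rule assms(2))
  ultimately show thesis
    using that[of "f \<circ> to_nat_on UNIV"] by (simp add: inj_compose)
qed

definition copy_map :: "('b \<Rightarrow> 'a) \<Rightarrow> ('b \<Rightarrow> 'b) \<Rightarrow> 'a \<Rightarrow> 'a" where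
  "copy_map i e = (\<lambda>a \<in> range i. i (e (inv_into UNIV i a)))"

lemma copy_map_apply: "inj i \<Longrightarrow> copy_map i e (i r) = i (e r)"
  by (simp add: copy_map_def)

text \<open>
  A ring endomorphism that creates no new degrees in the integer grading is compatible with every
  coarsening.
\<close>

lemma copy_map_graded_hom:
  assumes i: "inj i"
    and e: "e 1 = 1" "\<And>r s. e (r + s) = e r + e s" "\<And>r s. e (r * s) = e r * e s"
      "\<And>n r. \<pi> n r = 0 \<Longrightarrow> \<pi> n (e r) = 0"
  shows "copy_map i e \<in> graded_hom G (graded_copy i \<pi> G g) (graded_copy i \<pi> G g)"
  using e(4) unfolding graded_hom_def
  by (auto simp: graded_copy_sel copy_map_apply[OF i] i e(1-3) coarsening_def
      intro!: ring_hom_memI) (auto simp: copy_map_def)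

lemma Ann_sel:
  "obj (Ann U G) = {R. is_graded_ring G R \<and> carrier R \<prec> (UNIV :: 'a set)}"
  "arr (Ann U G) = graded_hom G"
  "cmp (Ann U G) = (\<lambda>R S T v u. compose (carrier R) v u)"
  for U :: "'a itself"
  by (simp_all add: Ann_def)

lemma (in int_grading) graded_copy_in_Ann:
  fixes i :: "'b \<Rightarrow> 'a"
  assumes "uncountable (UNIV :: 'a set)" and "countable (UNIV :: 'b set)" and "inj i"
    and "group G" and "g \<in> carrier G"
  shows "graded_copy i \<pi> G g \<in> obj (Ann TYPE('a) G)"
  using is_graded_ring_graded_copy[OF assms(3-5)] countable_range_lesspoll[OF assms(1,2), of i]
  by (simp add: Ann_sel graded_copy_sel)

section \<open>Laurent polynomials\<close>

abbreviation lookup :: "('k \<Rightarrow>\<^sub>0 'c::zero) \<Rightarrow> 'k \<Rightarrow> 'c" where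
  "lookup \<equiv> Poly_Mapping.lookup"

definition laurent_part :: "int \<Rightarrow> (int \<Rightarrow>\<^sub>0 rat) \<Rightarrow> (int \<Rightarrow>\<^sub>0 rat)" where
  "laurent_part n p = Poly_Mapping.single n (lookup p n)"

lemma laurent_part_eq_0: "laurent_part n p = 0 \<longleftrightarrow> lookup p n = 0"
  by (metis laurent_part_def lookup_single_eq lookup_zero single_zero)

interpretation laurent: int_grading laurent_part
proof
  fix m n r s
  show "laurent_part n (r + s) = laurent_part n r + laurent_part n s"
    by (simp add: laurent_part_def lookup_add single_add)
  show "laurent_part m (laurent_part n r) = (if m = n then laurent_part n r else 0)"
    by (simp add: laurent_part_def lookup_single_not_eq)
  show "finite {n. laurent_part n r \<noteq> 0}"
    by (simp add: laurent_part_eq_0)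
  show "(\<Sum>n | laurent_part n r \<noteq> 0. laurent_part n r) = r"
    unfolding laurent_part_eq_0
    by (rule poly_mapping_eqI) (simp add: lookup_sum laurent_part_def lookup_single when_def)
  show "laurent_part (m + n) (laurent_part m r * laurent_part n s)
      = laurent_part m r * laurent_part n s"
    by (simp add: laurent_part_def mult_single)
qed

text \<open>
  The automorphism \<open>x \<mapsto> 2 x\<close>.  The scalar \<open>2\<close> is a unit of infinite order in \<open>\<rat>\<close>, so only constants
  are fixed.
\<close>

definition laurent_scale :: "(int \<Rightarrow>\<^sub>0 rat) \<Rightarrow> (int \<Rightarrow>\<^sub>0 rat)" where
  "laurent_scale p = Abs_poly_mapping (\<lambda>n. 2 powi n * lookup p n)"

lemma lookup_laurent_scale: "lookup (laurent_scale p) n = 2 powi n * lookup p n"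
  unfolding laurent_scale_def
  by (subst lookup_Abs_poly_mapping) simp_all

lemma lookup_laurent_mult:
  fixes p q :: "int \<Rightarrow>\<^sub>0 rat"
  shows "lookup (p * q) n = (\<Sum>k. lookup p k * lookup q (n - k))"
proof -
  have "(\<Sum>l. (lookup q l when n = k + l)) = lookup q (n - k)" for k
  proof -
    have "(n = k + l) = (l = n - k)" for l
      by auto
    then show ?thesis
      by simp
  qed
  then show ?thesis
    by (simp add: lookup_mult)
qed

lemma laurent_scale_mult: "laurent_scale (p * q) = laurent_scale p * laurent_scale q"
proof (rule poly_mapping_eqI)
  fix n
  have "finite {k. lookup p k * lookup q (n - k) \<noteq> 0}"
    by (rule finite_subset[OF _ finite_lookup[of p]]) auto
  then have "lookup (laurent_scale (p * q)) n
      = (\<Sum>k. 2 powi n * (lookup p k * lookup q (n - k)))"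
    by (simp add: lookup_laurent_scale lookup_laurent_mult Sum_any_right_distrib)
  also have "\<dots> = (\<Sum>k. lookup (laurent_scale p) k * lookup (laurent_scale q) (n - k))"
    by (simp add: lookup_laurent_scale power_int_diff mult.left_commute)
  finally show "lookup (laurent_scale (p * q)) n
      = lookup (laurent_scale p * laurent_scale q) n"
    by (simp add: lookup_laurent_mult)
qed

lemma laurent_scale_add: "laurent_scale (p + q) = laurent_scale p + laurent_scale q"
  by (rule poly_mapping_eqI) (simp add: lookup_laurent_scale lookup_add algebra_simps)

lemma laurent_scale_1: "laurent_scale 1 = 1"
  by (rule poly_mapping_eqI) (auto simp: lookup_laurent_scale lookup_one when_def)

lemma laurent_scale_fixed:
  assumes "laurent_scale p = p" and "n \<noteq> 0"
  shows "laurent_part n p = 0"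
proof -
  have "(2 :: rat) powi n \<noteq> 1"
    using power_int_strict_increasing[of n 0 "2 :: rat"] power_int_strict_increasing[of 0 n "2 :: rat"]
      assms(2) by (cases "n < 0") auto
  moreover have "2 powi n * lookup p n = lookup p n"
    using assms(1) lookup_laurent_scale by metis
  ultimately show ?thesis
    by (simp add: laurent_part_eq_0)
qed

text \<open>
  A Laurent polynomial is determined by its graph over the support, a finite set of pairs.
\<close>

lemma countable_laurent: "countable (UNIV :: (int \<Rightarrow>\<^sub>0 rat) set)"
proof -
  let ?graph = "\<lambda>p :: int \<Rightarrow>\<^sub>0 rat. (\<lambda>n. (n, lookup p n)) ` {n. lookup p n \<noteq> 0}"
  have "inj ?graph"
  proof (rule injI, rule poly_mapping_eqI)
    fix p q n assume eq: "?graph p = ?graph q"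
    have "(n, c) \<in> ?graph r \<longleftrightarrow> c = lookup r n \<and> c \<noteq> 0" for c r
      by auto
    with eq show "lookup p n = lookup q n"
      by metis
  qed
  moreover have "range ?graph \<subseteq> {A. finite A}"
    by auto
  moreover have "countable {A :: (int \<times> rat) set. finite A}"
    by (rule countable_Collect_finite)
  ultimately show ?thesis
    by (meson countable_image_inj_on countable_subset)
qed

section \<open>The ring of integers with two square-zero variables\<close>

text \<open>
  \<open>Bidual a b c d\<close> stands for \<open>a + b x + c y + d x y\<close> in \<open>\<int>[x, y] / (x\<^sup>2, y\<^sup>2)\<close>.
\<close>

datatype bidual = Bidual (coeff_1: int) (coeff_x: int) (coeff_y: int) (coeff_xy: int)

instance bidual :: countable
  by countable_datatype

instantiation bidual :: comm_ring_1
begin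

definition "0 = Bidual 0 0 0 0"

definition "1 = Bidual 1 0 0 0"

definition
  "r + s = Bidual (coeff_1 r + coeff_1 s) (coeff_x r + coeff_x s) (coeff_y r + coeff_y s)
     (coeff_xy r + coeff_xy s)"

definition
  "r - s = Bidual (coeff_1 r - coeff_1 s) (coeff_x r - coeff_x s) (coeff_y r - coeff_y s)
     (coeff_xy r - coeff_xy s)"

definition "- r = Bidual (- coeff_1 r) (- coeff_x r) (- coeff_y r) (- coeff_xy r)"

definition
  "r * s = Bidual
     (coeff_1 r * coeff_1 s)
     (coeff_1 r * coeff_x s + coeff_x r * coeff_1 s)
     (coeff_1 r * coeff_y s + coeff_y r * coeff_1 s)
     (coeff_1 r * coeff_xy s + coeff_xy r * coeff_1 s + coeff_x r * coeff_y s + coeff_y r * coeff_x s)"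

instance
  by standard
    (simp_all add: zero_bidual_def one_bidual_def plus_bidual_def minus_bidual_def uminus_bidual_def
      times_bidual_def algebra_simps)

end

lemmas bidual_defs = zero_bidual_def one_bidual_def plus_bidual_def times_bidual_def

text \<open>
  The grading with \<open>x\<close> in degree \<open>1\<close> and \<open>y\<close> in degree \<open>- 1\<close>.
\<close>

definition bidual_part :: "int \<Rightarrow> bidual \<Rightarrow> bidual" where
  "bidual_part n r =
    (if n = 0 then Bidual (coeff_1 r) 0 0 (coeff_xy r)
     else if n = 1 then Bidual 0 (coeff_x r) 0 0
     else if n = - 1 then Bidual 0 0 (coeff_y r) 0
     else 0)"

interpretation bidual: int_grading bidual_part
proof
  fix m n r s
  show "bidual_part n (r + s) = bidual_part n r + bidual_part n s"
    by (simp add: bidual_part_def bidual_defs)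
  show "bidual_part m (bidual_part n r) = (if m = n then bidual_part n r else 0)"
    by (simp add: bidual_part_def bidual_defs)
  have supp: "{n. bidual_part n r \<noteq> 0} \<subseteq> {0, 1, - 1}"
    by (auto simp: bidual_part_def)
  then show "finite {n. bidual_part n r \<noteq> 0}"
    by (rule finite_subset) simp
  have "(\<Sum>n | bidual_part n r \<noteq> 0. bidual_part n r) = (\<Sum>n\<in>{0, 1, - 1}. bidual_part n r)"
    by (rule sum.mono_neutral_left[OF _ supp]) auto
  also have "\<dots> = r"
    by (cases r) (simp add: bidual_part_def bidual_defs)
  finally show "(\<Sum>n | bidual_part n r \<noteq> 0. bidual_part n r) = r" .
  show "bidual_part (m + n) (bidual_part m r * bidual_part n s) = bidual_part m r * bidual_part n s"
    by (auto simp: bidual_part_def bidual_defs)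
qed

text \<open>
  The substitution \<open>x \<mapsto> p x\<close>, \<open>y \<mapsto> q y\<close>.  On the part of degree \<open>0\<close>, spanned by \<open>1\<close> and \<open>x y\<close>, it
  depends only on the product \<open>p q\<close>.
\<close>

definition bidual_subst :: "int \<Rightarrow> int \<Rightarrow> bidual \<Rightarrow> bidual" where
  "bidual_subst p q r = Bidual (coeff_1 r) (p * coeff_x r) (q * coeff_y r) (p * q * coeff_xy r)"

lemma bidual_subst_hom:
  "bidual_subst p q 1 = 1"
  "bidual_subst p q (r + s) = bidual_subst p q r + bidual_subst p q s"
  "bidual_subst p q (r * s) = bidual_subst p q r * bidual_subst p q s"
  "bidual_part n r = 0 \<Longrightarrow> bidual_part n (bidual_subst p q r) = 0"
  by (auto simp: bidual_subst_def bidual_defs bidual_part_def algebra_simps split: if_splits)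

lemma coeff_bidual:
  "coeff_x 1 = 0" "coeff_x (r + s) = coeff_x r + coeff_x s"
  "coeff_x (r * s) = coeff_1 r * coeff_x s + coeff_x r * coeff_1 s"
  "coeff_y 1 = 0" "coeff_y (r + s) = coeff_y r + coeff_y s"
  "coeff_y (r * s) = coeff_1 r * coeff_y s + coeff_y r * coeff_1 s"
  by (simp_all add: bidual_defs)

lemma coarsening_bidual:
  assumes "group G" and g: "g \<in> carrier G"
  shows "r \<in> coarsening bidual_part G g h \<longleftrightarrow>
    (coeff_1 r \<noteq> 0 \<or> coeff_xy r \<noteq> 0 \<longrightarrow> h = \<one>\<^bsub>G\<^esub>) \<and>
    (coeff_x r \<noteq> 0 \<longrightarrow> h = g) \<and> (coeff_y r \<noteq> 0 \<longrightarrow> h = inv\<^bsub>G\<^esub> g)"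
proof -
  interpret group G by fact
  have "bidual_part n r = 0" if "n \<notin> {0, 1, - 1}" for n
    using that by (simp add: bidual_part_def)
  then have "(\<forall>n. bidual_part n r \<noteq> 0 \<longrightarrow> g [^]\<^bsub>G\<^esub> n = h) \<longleftrightarrow>
    (\<forall>n\<in>{0, 1, - 1}. bidual_part n r \<noteq> 0 \<longrightarrow> g [^]\<^bsub>G\<^esub> n = h)"
    by blast
  also have "\<dots> \<longleftrightarrow> (coeff_1 r \<noteq> 0 \<or> coeff_xy r \<noteq> 0 \<longrightarrow> h = \<one>\<^bsub>G\<^esub>) \<and> (coeff_x r \<noteq> 0 \<longrightarrow> h = g) \<and>
    (coeff_y r \<noteq> 0 \<longrightarrow> h = inv\<^bsub>G\<^esub> g)"
    using g int_pow_neg[OF g, of 1] by (auto simp: bidual_part_def bidual_defs)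
  finally show ?thesis
    by (simp add: coarsening_def)
qed

section \<open>Restriction, corestriction and the zero ring\<close>

lemma restricted_ring_sel:
  "carrier (restricted_ring F \<phi> R) = generate (add_monoid R) (\<Union>f \<in> carrier F. component R (\<phi> f))"
  "mult (restricted_ring F \<phi> R) = mult R"
  "one (restricted_ring F \<phi> R) = one R"
  "zero (restricted_ring F \<phi> R) = zero R"
  "add (restricted_ring F \<phi> R) = add R"
  "component (restricted_ring F \<phi> R) f = component R (\<phi> f)"
  by (simp_all add: restricted_ring_def ring.defs graded_ring.defs)

lemma quotient_graded_ring_sel:
  "carrier (quotient_graded_ring R I) = carrier (R Quot I)"
  "mult (quotient_graded_ring R I) = mult (R Quot I)"
  "one (quotient_graded_ring R I) = one (R Quot I)"
  "zero (quotient_graded_ring R I) = zero (R Quot I)"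
  "add (quotient_graded_ring R I) = add (R Quot I)"
  "component (quotient_graded_ring R I) g = (\<lambda>r. I +>\<^bsub>R\<^esub> r) ` component R g"
  by (simp_all add: quotient_graded_ring_def ring.defs graded_ring.defs)

lemma transport_ring_sel:
  "carrier (transport_ring i R) = i ` carrier R"
  "mult (transport_ring i R) =
    (\<lambda>a b. i (inv_into (carrier R) i a \<otimes>\<^bsub>R\<^esub> inv_into (carrier R) i b))"
  "one (transport_ring i R) = i \<one>\<^bsub>R\<^esub>"
  "zero (transport_ring i R) = i \<zero>\<^bsub>R\<^esub>"
  "add (transport_ring i R) =
    (\<lambda>a b. i (inv_into (carrier R) i a \<oplus>\<^bsub>R\<^esub> inv_into (carrier R) i b))"
  "component (transport_ring i R) g = i ` component R g"
  by (simp_all add: transport_ring_def image_ring_def image_group_def ring.defs monoid.defs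
      graded_ring.defs)

lemma component_subset_carrier:
  "is_graded_ring G R \<Longrightarrow> g \<in> carrier G \<Longrightarrow> component R g \<subseteq> carrier R"
  unfolding is_graded_ring_def by (blast dest: additive_subgroup.a_subset)

definition zero_graded_ring :: "'a \<Rightarrow> ('a, 'g) graded_ring" where
  "zero_graded_ring z =
    \<lparr> carrier = {z}, mult = (\<lambda>_ _. z), one = z, zero = z, add = (\<lambda>_ _. z),
      component = (\<lambda>_. {z}) \<rparr>"

lemma zero_graded_ring_sel:
  "carrier (zero_graded_ring z) = {z}"
  "mult (zero_graded_ring z) = (\<lambda>_ _. z)"
  "one (zero_graded_ring z) = z"
  "zero (zero_graded_ring z) = z"
  "add (zero_graded_ring z) = (\<lambda>_ _. z)"
  "component (zero_graded_ring z) = (\<lambda>_. {z})"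
  by (simp_all add: zero_graded_ring_def)

lemma is_graded_ring_zero_graded_ring: "is_graded_ring F (zero_graded_ring z)"
    (is "is_graded_ring F ?Z")
proof -
  have "cring ?Z"
    by (rule cringI)
      (auto intro!: abelian_groupI comm_monoidI simp: zero_graded_ring_sel)
  then interpret Z: cring ?Z .
  have "additive_subgroup {z} ?Z"
    using Z.zeroideal ideal.axioms(1) by (fastforce simp: zero_graded_ring_sel)
  moreover have "\<exists>!x. x \<in> (\<Pi>\<^sub>E f \<in> carrier F. {z}) \<and> finite {f \<in> carrier F. x f \<noteq> z} \<and>
       r = (\<Oplus>\<^bsub>?Z\<^esub> f \<in> {f \<in> carrier F. x f \<noteq> z}. x f)" if "r \<in> carrier ?Z" for r
  proof (rule ex1I[of _ "\<lambda>f\<in>carrier F. z"])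
    have [simp]: "{f \<in> carrier F. (\<lambda>f\<in>carrier F. z) f \<noteq> z} = {}"
      by auto
    show "(\<lambda>f\<in>carrier F. z) \<in> (\<Pi>\<^sub>E f \<in> carrier F. {z}) \<and>
        finite {f \<in> carrier F. (\<lambda>f\<in>carrier F. z) f \<noteq> z} \<and>
       r = (\<Oplus>\<^bsub>?Z\<^esub> f \<in> {f \<in> carrier F. (\<lambda>f\<in>carrier F. z) f \<noteq> z}. (\<lambda>f\<in>carrier F. z) f)"
      using that by (simp add: zero_graded_ring_sel)
  qed (auto simp: PiE_singleton)
  ultimately show ?thesis
    unfolding is_graded_ring_def using Z.is_cring by (simp add: zero_graded_ring_sel)
qed

text \<open>
  In the zero ring the only element is \<open>1\<close>, and its image is prescribed.
\<close>

lemma zero_ring_hom_unique: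
  assumes "u \<in> graded_hom F (zero_graded_ring z) X" and "v \<in> graded_hom F (zero_graded_ring z) X"
  shows "u = v"
proof (rule extensionalityI)
  have "u z = \<one>\<^bsub>X\<^esub>" "v z = \<one>\<^bsub>X\<^esub>"
    using assms by (auto simp: graded_hom_def zero_graded_ring_sel dest!: ring_hom_one)
  then show "u x = v x" if "x \<in> {z}" for x
    using that by simp
  show "u \<in> extensional {z}" "v \<in> extensional {z}"
    using assms by (auto simp: graded_hom_def zero_graded_ring_sel)
qed

section \<open>Corestriction has no left adjoint\<close>

text \<open>
  Distinct cosets are disjoint, so a chosen element determines its coset.  Hence passing to
  representatives loses no information on the corestriction.
\<close>

lemma inj_on_coset_rep:
  assumes "ideal I R"
  shows "inj_on coset_rep (carrier (R Quot I))"
proof (rule inj_onI)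
  interpret ideal I R by fact
  interpret abelian_subgroup I R by (rule abelian_subgroupI3[OF is_additive_subgroup is_abelian_group])
  have rep: "coset_rep K \<in> K" if K: "K \<in> a_rcosets\<^bsub>R\<^esub> I" for K
  proof -
    obtain r where "r \<in> carrier R" "K = I +>\<^bsub>R\<^esub> r"
      using K by (auto simp: A_RCOSETS_def')
    then show ?thesis
      unfolding coset_rep_def using a_rcos_self by (metis someI)
  qed
  fix K K'
  assume "K \<in> carrier (R Quot I)" "K' \<in> carrier (R Quot I)" and eq: "coset_rep K = coset_rep K'"
  then have K: "K \<in> a_rcosets\<^bsub>R\<^esub> I" "K' \<in> a_rcosets\<^bsub>R\<^esub> I"
    by (simp_all add: FactRing_def)
  then have "\<not> disjnt K K'"
    using rep[of K] rep[of K'] eq by (auto simp: disjnt_def)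
  then show "K = K'"
    using a_rcos_disjoint K by (auto dest: pairwiseD)
qed

lemma corestricted_ring_sel:
  fixes R :: "('a, 'g) graded_ring" and F :: "('f, 'x) monoid_scheme"
    and G :: "('g, 'y) monoid_scheme" and \<phi> :: "'f \<Rightarrow> 'g"
  defines "I \<equiv> corestriction_ideal F G \<phi> R"
  shows
  "mult (corestricted_ring F G \<phi> R) = mult (R Quot I)"
  "one (corestricted_ring F G \<phi> R) = I +>\<^bsub>R\<^esub> \<one>\<^bsub>R\<^esub>"
  "zero (corestricted_ring F G \<phi> R) = I"
  "add (corestricted_ring F G \<phi> R) = add (R Quot I)"
  "component (corestricted_ring F G \<phi> R) f = (\<lambda>r. I +>\<^bsub>R\<^esub> r) ` component R (\<phi> f)"
  by (simp_all add: corestricted_ring_def restricted_ring_sel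
      quotient_graded_ring_sel I_def FactRing_def)

lemma ideal_corestriction_ideal:
  assumes "is_graded_ring G R"
  shows "ideal (corestriction_ideal F G \<phi> R) R"
proof -
  interpret cring R using assms by (simp add: is_graded_ring_def)
  show ?thesis
    unfolding corestriction_ideal_def
    by (rule genideal_ideal) (use component_subset_carrier[OF assms] in blast)
qed

lemma carrier_corestricted_ring:
  assumes R: "is_graded_ring G R" and \<phi>: "\<phi> \<in> carrier F \<rightarrow> carrier G"
  shows "carrier (corestricted_ring F G \<phi> R) \<subseteq> carrier (R Quot corestriction_ideal F G \<phi> R)"
    and "f \<in> carrier F \<Longrightarrow>
      component (corestricted_ring F G \<phi> R) f \<subseteq> carrier (corestricted_ring F G \<phi> R)"
    and "\<zero>\<^bsub>corestricted_ring F G \<phi> R\<^esub> \<in> carrier (corestricted_ring F G \<phi> R)"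
proof -
  let ?I = "corestriction_ideal F G \<phi> R"
  interpret ideal ?I R by (rule ideal_corestriction_ideal[OF R])
  interpret Q: ring "R Quot ?I" by (rule quotient_is_ring)
  have add: "group (add_monoid (quotient_graded_ring R ?I))"
  proof (rule groupI)
    fix K assume "K \<in> carrier (add_monoid (quotient_graded_ring R ?I))"
    then have K: "K \<in> carrier (R Quot ?I)"
      by (simp add: quotient_graded_ring_sel)
    show "\<exists>K'\<in>carrier (add_monoid (quotient_graded_ring R ?I)).
        K' \<otimes>\<^bsub>add_monoid (quotient_graded_ring R ?I)\<^esub> K
          = \<one>\<^bsub>add_monoid (quotient_graded_ring R ?I)\<^esub>"
      by (rule bexI[of _ "\<ominus>\<^bsub>R Quot ?I\<^esub> K"])
        (use K Q.l_neg[OF K] in \<open>simp_all add: quotient_graded_ring_sel\<close>)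
  qed (auto simp: quotient_graded_ring_sel Q.a_assoc)
  have "(\<lambda>r. ?I +>\<^bsub>R\<^esub> r) ` component R (\<phi> f) \<subseteq> carrier (R Quot ?I)" if "f \<in> carrier F" for f
    using component_subset_carrier[OF R, of "\<phi> f"] \<phi> that a_rcosetsI[OF a_subset]
    by (auto simp: FactRing_def)
  then show "carrier (corestricted_ring F G \<phi> R) \<subseteq> carrier (R Quot ?I)"
    unfolding corestricted_ring_def restricted_ring_sel
    using group.generate_incl[OF add,
      of "\<Union>f \<in> carrier F. component (quotient_graded_ring R ?I) (\<phi> f)"]
    by (simp add: quotient_graded_ring_sel UN_subset_iff)
  show "component (corestricted_ring F G \<phi> R) f \<subseteq> carrier (corestricted_ring F G \<phi> R)"
    if "f \<in> carrier F" for f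
    using that unfolding corestricted_ring_def restricted_ring_sel by (auto intro: generate.incl)
  show "\<zero>\<^bsub>corestricted_ring F G \<phi> R\<^esub> \<in> carrier (corestricted_ring F G \<phi> R)"
    unfolding corestricted_ring_def restricted_ring_sel
    using generate.one[of "add_monoid (quotient_graded_ring R ?I)"] by simp
qed

text \<open>
  A morphism from the zero ring forces \<open>1 + 1 = 1\<close> in the target, because \<open>1 + 1 = 1\<close> in the zero
  ring; so \<open>1 = 0\<close> modulo the ideal.  The grading is used to see that the class of \<open>1\<close> belongs to the
  corestricted ring: the image of the component of degree \<open>\<one>\<close> lies in such a component.
\<close>

lemma zero_ring_hom_imp_one_in_ideal:
  fixes F :: "('f, 'x) monoid_scheme"
  assumes R: "is_graded_ring G R" and \<phi>: "\<phi> \<in> carrier F \<rightarrow> carrier G" and F: "group F"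
    and u: "u \<in> graded_hom F (zero_graded_ring z) (on_obj (corestriction F G \<phi>) R)"
  shows "\<one>\<^bsub>R\<^esub> \<in> corestriction_ideal F G \<phi> R"
proof -
  define I where "I = corestriction_ideal F G \<phi> R"
  define T where "T = corestricted_ring F G \<phi> R"
  interpret ideal I R unfolding I_def by (rule ideal_corestriction_ideal[OF R])
  interpret Q: ring "R Quot I" by (rule quotient_is_ring)
  have T: "on_obj (corestriction F G \<phi>) R = transport_ring coset_rep T"
    by (simp add: corestriction_def T_def)
  have hom: "u \<in> ring_hom (zero_graded_ring z :: (_, 'f) graded_ring) (transport_ring coset_rep T)"
    using u by (simp add: graded_hom_def T)
  have TQ: "carrier T \<subseteq> carrier (R Quot I)"
    unfolding T_def I_def by (rule carrier_corestricted_ring[OF R \<phi>])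
  have inj: "inj_on coset_rep (carrier (R Quot I))"
    by (rule inj_on_coset_rep) (rule ideal_axioms)
  have one: "u z = coset_rep (I +>\<^bsub>R\<^esub> \<one>\<^bsub>R\<^esub>)"
    using ring_hom_one[OF hom]
    by (simp add: zero_graded_ring_sel transport_ring_sel T_def I_def corestricted_ring_sel)
  have "u z \<in> coset_rep ` component T \<one>\<^bsub>F\<^esub>"
    using u monoid.one_closed[OF group.is_monoid[OF F]]
    by (auto simp: graded_hom_def T zero_graded_ring_sel transport_ring_sel)
  moreover have "component T \<one>\<^bsub>F\<^esub> \<subseteq> carrier T"
    unfolding T_def
    by (rule carrier_corestricted_ring[OF R \<phi>]) (rule monoid.one_closed[OF group.is_monoid[OF F]])
  ultimately obtain K where K: "K \<in> carrier T" "u z = coset_rep K"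
    by auto
  have K1: "K = \<one>\<^bsub>R Quot I\<^esub>"
  proof (rule inj_onD[OF inj])
    show "coset_rep K = coset_rep \<one>\<^bsub>R Quot I\<^esub>"
      using K one by (simp add: FactRing_def)
  qed (use K TQ in auto)
  have "inv_into (carrier T) coset_rep (coset_rep K) = K"
    by (rule inv_into_f_f[OF inj_on_subset[OF inj TQ] K(1)])
  then have "coset_rep K = coset_rep (K \<oplus>\<^bsub>R Quot I\<^esub> K)"
    using ring_hom_add[OF hom, of z z] K(2)
    by (simp add: zero_graded_ring_sel transport_ring_sel T_def corestricted_ring_sel I_def)
  then have "K = K \<oplus>\<^bsub>R Quot I\<^esub> K"
    using inj_onD[OF inj] K1 by auto
  then have "\<one>\<^bsub>R Quot I\<^esub> = \<zero>\<^bsub>R Quot I\<^esub>"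
    unfolding K1 by simp
  then have "I +>\<^bsub>R\<^esub> \<one>\<^bsub>R\<^esub> = I"
    by (simp add: FactRing_def)
  then have "\<one>\<^bsub>R\<^esub> \<in> I"
    using abelian_subgroup.a_rcos_self[OF abelian_subgroupI3[OF is_additive_subgroup
      is_abelian_group]]
    by auto
  then show ?thesis
    by (simp add: I_def)
qed

text \<open>
  The quotient by the whole ring has the ideal itself as its only coset.
\<close>

lemma one_in_ideal_imp_zero_ring_hom:
  assumes R: "is_graded_ring G R" and \<phi>: "\<phi> \<in> carrier F \<rightarrow> carrier G"
    and one: "\<one>\<^bsub>R\<^esub> \<in> corestriction_ideal F G \<phi> R"
  shows "graded_hom F (zero_graded_ring z) (on_obj (corestriction F G \<phi>) R) \<noteq> {}"
proof -
  define I where "I = corestriction_ideal F G \<phi> R"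
  define T where "T = corestricted_ring F G \<phi> R"
  interpret ideal I R unfolding I_def by (rule ideal_corestriction_ideal[OF R])
  interpret Q: ring "R Quot I" by (rule quotient_is_ring)
  have T: "on_obj (corestriction F G \<phi>) R = transport_ring coset_rep T"
    by (simp add: corestriction_def T_def)
  have I: "I = carrier R"
    using one_imp_carrier one by (simp add: I_def)
  have coset: "I +>\<^bsub>R\<^esub> r = I" if "r \<in> I" for r
    using abelian_subgroup.a_rcos_const[OF abelian_subgroupI3[OF is_additive_subgroup
      is_abelian_group]] that .
  have Q: "carrier (R Quot I) = {I}"
    using coset I by (auto simp: FactRing_def A_RCOSETS_def')
  have "carrier T \<subseteq> {I}"
    using carrier_corestricted_ring(1)[OF R \<phi>] Q by (simp add: T_def I_def)
  moreover have "I \<in> carrier T"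
    using carrier_corestricted_ring(3)[OF R \<phi>] by (simp add: T_def I_def corestricted_ring_sel)
  ultimately have carrier: "carrier T = {I}"
    by blast
  have comp: "I \<in> component T f" if f: "f \<in> carrier F" for f
  proof -
    have "additive_subgroup (component R (\<phi> f)) R"
      using R \<phi> f by (auto simp: is_graded_ring_def)
    then have "\<zero>\<^bsub>R\<^esub> \<in> component R (\<phi> f)"
      by (rule additive_subgroup.zero_closed)
    then show ?thesis
      using coset[OF additive_subgroup.zero_closed[OF is_additive_subgroup]]
      by (force simp: T_def corestricted_ring_sel I_def)
  qed
  have ops: "I \<otimes>\<^bsub>T\<^esub> I = I" "I \<oplus>\<^bsub>T\<^esub> I = I" "\<one>\<^bsub>T\<^esub> = I"
    using Q.m_closed[of I I] Q.a_closed[of I I] Q.one_closed Q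
    by (simp_all add: T_def corestricted_ring_sel I_def[symmetric]) (simp add: FactRing_def)
  have inv: "inv_into {I} coset_rep (coset_rep I) = I"
    by simp
  have "(\<lambda>x\<in>{z}. coset_rep I) \<in> graded_hom F (zero_graded_ring z) (transport_ring coset_rep T)"
    unfolding graded_hom_def
    by (auto intro!: ring_hom_memI imageI comp
        simp: zero_graded_ring_sel transport_ring_sel carrier inv ops)
  then show ?thesis
    unfolding T by blast
qed

text \<open>
  The adjunction bijections at the zero ring would make \<open>L 0\<close> a graded ring \<open>M\<close> with exactly one
  morphism to every \<open>Y\<close> with \<open>1 \<in> \<aa>\<^sub>\<phi>(Y)\<close> and none to any other \<open>Y\<close>.  No such \<open>M\<close> exists:
  taking \<open>Y = M\<close> and \<open>Y = \<rat>[x, x\<^bsup>-1\<^esup>]\<close> gives a contradiction.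
\<close>

theorem corestriction_no_left_adjoint:
  fixes F :: "('f, 'x) monoid_scheme" and G :: "('g, 'y) monoid_scheme" and \<phi> :: "'f \<Rightarrow> 'g"
  assumes U: "uncountable (UNIV :: 'a set)"
    and F: "group F" and G: "group G" and \<phi>: "\<phi> \<in> hom F G"
    and g: "g \<in> carrier G" "g \<notin> \<phi> ` carrier F"
  shows "\<not> has_left_adjoint (Ann TYPE('a) G) (Ann TYPE('a) F) (corestriction F G \<phi>)"
proof
  assume "has_left_adjoint (Ann TYPE('a) G) (Ann TYPE('a) F) (corestriction F G \<phi>)"
  then obtain L \<Phi> where L: "is_functor (Ann TYPE('a) F) (Ann TYPE('a) G) L"
    and adj: "adjunction (Ann TYPE('a) G) (Ann TYPE('a) F) L (corestriction F G \<phi>) \<Phi>"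
    unfolding has_left_adjoint_def by blast
  have \<phi>': "\<phi> \<in> carrier F \<rightarrow> carrier G"
    using \<phi> by (simp add: hom_def)
  obtain i :: "(int \<Rightarrow>\<^sub>0 rat) \<Rightarrow> 'a" where i: "inj i"
    using obtain_injection[OF U countable_laurent] .
  define Z :: "('a, 'f) graded_ring" where "Z = zero_graded_ring (i 0)"
  define S where "S = graded_copy i laurent_part G g"
  have Z: "Z \<in> obj (Ann TYPE('a) F)"
    using countable_range_lesspoll[OF U, of "\<lambda>_::unit. i 0"]
    by (simp add: Ann_sel is_graded_ring_zero_graded_ring Z_def zero_graded_ring_sel)
  have S: "S \<in> obj (Ann TYPE('a) G)"
    unfolding S_def by (rule laurent.graded_copy_in_Ann[OF U countable_laurent i G g(1)])
  define M where "M = on_obj L Z"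
  have M: "M \<in> obj (Ann TYPE('a) G)"
    using L Z by (auto simp: is_functor_def M_def)
  have bij: "bij_betw (\<Phi> Z Y) (graded_hom G M Y)
      (graded_hom F Z (on_obj (corestriction F G \<phi>) Y))" if "Y \<in> obj (Ann TYPE('a) G)" for Y
    using adj Z that unfolding adjunction_def M_def Ann_sel(2) by blast
  have graded: "is_graded_ring G M" "is_graded_ring G S"
    using M S by (simp_all add: Ann_sel)
  interpret M: cring M using graded by (simp add: is_graded_ring_def)
  interpret S: cring S using graded by (simp add: is_graded_ring_def)
  have "restrict id (carrier M) \<in> graded_hom G M M"
    unfolding graded_hom_def using component_subset_carrier[OF graded(1)]
    by (auto intro!: ring_hom_memI)
  then have "graded_hom F Z (on_obj (corestriction F G \<phi>) M) \<noteq> {}"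
    using bij_betwE[OF bij[OF M]] by blast
  then obtain w where "w \<in> graded_hom F Z (on_obj (corestriction F G \<phi>) M)"
    by blast
  then have one_M: "\<one>\<^bsub>M\<^esub> \<in> corestriction_ideal F G \<phi> M"
    unfolding Z_def by (rule zero_ring_hom_imp_one_in_ideal[OF graded(1) \<phi>' F])

  \<comment> \<open>\<open>x\<close> is a unit in the ideal, with inverse \<open>y\<close>.\<close>
  define x where "x = i (Poly_Mapping.single 1 1)"
  define y where "y = i (Poly_Mapping.single (- 1) 1)"
  have "y \<otimes>\<^bsub>S\<^esub> x = \<one>\<^bsub>S\<^esub>"
    using i by (simp add: S_def graded_copy_sel x_def y_def mult_single)
  moreover have "Poly_Mapping.single 1 1 \<in> coarsening laurent_part G g g"
    using group.int_pow_1[OF G g(1)] laurent_part_eq_0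
    by (auto simp: coarsening_def lookup_single when_def split: if_splits)
  then have "x \<in> component S g"
    by (simp add: S_def graded_copy_sel x_def)
  then have "x \<in> corestriction_ideal F G \<phi> S"
    unfolding corestriction_ideal_def
    using S.genideal_self[of "\<Union>g \<in> carrier G - \<phi> ` carrier F. component S g"]
      component_subset_carrier[OF graded(2)] g by blast
  moreover have "y \<in> carrier S"
    by (simp add: S_def graded_copy_sel y_def)
  ultimately have "\<one>\<^bsub>S\<^esub> \<in> corestriction_ideal F G \<phi> S"
    using ideal.I_l_closed[OF ideal_corestriction_ideal[OF graded(2)]] by metis
  then have "graded_hom F Z (on_obj (corestriction F G \<phi>) S) \<noteq> {}"
    unfolding Z_def by (rule one_in_ideal_imp_zero_ring_hom[OF graded(2) \<phi>'])
  then obtain f where f: "f \<in> graded_hom G M S"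
    using bij_betw_imp_surj_on[OF bij[OF S]] by blast
  have unique: "v = f" if "v \<in> graded_hom G M S" for v
  proof (rule inj_onD[OF bij_betw_imp_inj_on[OF bij[OF S]]])
    show "\<Phi> Z S v = \<Phi> Z S f"
      using bij_betwE[OF bij[OF S]] that f unfolding Z_def
      by (blast intro: zero_ring_hom_unique)
  qed (use that f in auto)

  let ?c = "copy_map i laurent_scale"
  have c: "?c \<in> graded_hom G S S"
    unfolding S_def
    by (rule copy_map_graded_hom[OF i laurent_scale_1 laurent_scale_add laurent_scale_mult])
      (simp add: laurent_part_eq_0 lookup_laurent_scale)
  have f_hom: "f \<in> ring_hom M S" and c_hom: "?c \<in> ring_hom S S"
    using f c by (simp_all add: graded_hom_def)
  interpret f: ring_hom_ring M S f
    by (rule ring_hom_ringI2[OF M.ring_axioms S.ring_axioms f_hom])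
  have "compose (carrier M) ?c f \<in> graded_hom G M S"
  proof -
    have "compose (carrier M) ?c f \<in> ring_hom M S"
      using f_hom c_hom by (auto intro!: ring_hom_memI simp: compose_def
          ring_hom_closed ring_hom_mult ring_hom_add ring_hom_one)
    moreover have "compose (carrier M) ?c f ` component M h \<subseteq> component S h"
      if "h \<in> carrier G" for h
    proof -
      have "f ` component M h \<subseteq> component S h" "?c ` component S h \<subseteq> component S h"
        using f c that by (auto simp: graded_hom_def)
      then show ?thesis
        using component_subset_carrier[OF graded(1) that] by (auto simp: compose_def)
    qed
    ultimately show ?thesis
      by (simp add: graded_hom_def)
  qed
  then have eq: "compose (carrier M) ?c f = f"
    by (rule unique)
  \<comment> \<open>A value of \<open>f\<close> is fixed by \<open>x \<mapsto> 2 x\<close>, hence constant.\<close>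
  have degree_0: "laurent_part n r = 0" if "m \<in> carrier M" "f m = i r" "n \<noteq> 0" for m r n
  proof -
    have "?c (f m) = f m"
      using fun_cong[OF eq, of m] that by (simp add: compose_def)
    then have "laurent_scale r = r"
      using i that by (simp add: copy_map_apply inj_eq)
    then show ?thesis
      using that by (simp add: laurent_scale_fixed)
  qed
  have "component M h \<subseteq> a_kernel M S f" if h: "h \<in> carrier G - \<phi> ` carrier F" for h
  proof
    fix m assume m: "m \<in> component M h"
    then have mM: "m \<in> carrier M"
      using component_subset_carrier[OF graded(1)] h by blast
    have "f m \<in> component S h"
      using f m h by (auto simp: graded_hom_def)
    then obtain r where r: "f m = i r" "r \<in> coarsening laurent_part G g h"
      by (auto simp: S_def graded_copy_sel)
    \<comment> \<open>The degrees \<open>h\<close> and \<open>0\<close> are different, so \<open>f m\<close>, being homogeneous of both, is \<open>0\<close>.\<close>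
    have "h \<noteq> g [^]\<^bsub>G\<^esub> (0 :: int)"
      using h group_hom.hom_one[OF group_hom.intro[OF F G group_hom_axioms.intro[OF \<phi>]]]
        monoid.one_closed[OF group.is_monoid[OF F]] by (auto simp: image_iff)
    then have "laurent_part n r = laurent_part n 0" for n
      using r degree_0[OF mM r(1), of n] by (cases "n = 0") (auto simp: coarsening_def)
    then have "r = 0"
      by (rule laurent.proj_eqI)
    then show "m \<in> a_kernel M S f"
      unfolding a_kernel_def' using mM r(1) by (simp add: S_def graded_copy_sel(4))
  qed
  then have "corestriction_ideal F G \<phi> M \<subseteq> a_kernel M S f"
    unfolding corestriction_ideal_def
    by (intro M.genideal_minimal[OF f.kernel_is_ideal] UN_least)
  then have "\<one>\<^bsub>M\<^esub> \<in> a_kernel M S f"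
    using one_M by (rule subsetD)
  then have "f \<one>\<^bsub>M\<^esub> = \<zero>\<^bsub>S\<^esub>"
    by (rule f.kernel_zero)
  then have "\<one>\<^bsub>S\<^esub> = \<zero>\<^bsub>S\<^esub>"
    by (simp only: f.hom_one)
  then show False
    unfolding S_def graded_copy_sel inj_eq[OF i] by simp
qed

section \<open>Restriction has no right adjoint\<close>

text \<open>
  Equivalently, restriction does not preserve the coequalizer of \<open>E 0 1\<close> and \<open>E 0 0\<close>: these
  endomorphisms of \<open>P\<close> agree on the restriction \<open>N\<close>, whereas their coequalizer is \<open>P / (y)\<close>, in which
  \<open>x y\<close> vanishes.
\<close>

theorem restriction_no_right_adjoint:
  fixes F :: "('f, 'x) monoid_scheme" and G :: "('g, 'y) monoid_scheme" and \<phi> :: "'f \<Rightarrow> 'g"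
  assumes U: "uncountable (UNIV :: 'a set)"
    and F: "group F" and G: "group G" and \<phi>: "\<phi> \<in> mon F G"
    and g: "g \<in> carrier G" "g \<notin> \<phi> ` carrier F"
  shows "\<not> has_right_adjoint (Ann TYPE('a) G) (Ann TYPE('a) F) (restriction F \<phi>)"
proof
  assume "has_right_adjoint (Ann TYPE('a) G) (Ann TYPE('a) F) (restriction F \<phi>)"
  then obtain D \<Phi> where D: "is_functor (Ann TYPE('a) F) (Ann TYPE('a) G) D"
    and adj: "adjunction (Ann TYPE('a) F) (Ann TYPE('a) G) (restriction F \<phi>) D \<Phi>"
    unfolding has_right_adjoint_def by blast
  interpret F: group F by fact
  interpret G: group G by fact
  interpret \<phi>: group_hom F G \<phi>
    using \<phi> by unfold_locales (simp add: mon_def)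
  obtain i :: "bidual \<Rightarrow> 'a" where i: "inj i"
    using obtain_injection[OF U countableI_type] .
  define P where "P = graded_copy i bidual_part G g"
  \<comment> \<open>The same ring, now graded by \<open>F\<close> and concentrated in degree \<open>\<one>\<close>.\<close>
  define Y where "Y = graded_copy i bidual_part F \<one>\<^bsub>F\<^esub>"
  have P: "P \<in> obj (Ann TYPE('a) G)"
    unfolding P_def by (rule bidual.graded_copy_in_Ann[OF U _ i G g(1)]) simp
  have Y: "Y \<in> obj (Ann TYPE('a) F)"
    unfolding Y_def by (rule bidual.graded_copy_in_Ann[OF U _ i F F.one_closed]) simp
  have graded: "is_graded_ring G P" "is_graded_ring F Y"
    using P Y by (simp_all add: Ann_sel)
  interpret P: cring P using graded by (simp add: is_graded_ring_def)
  interpret Y: cring Y using graded by (simp add: is_graded_ring_def)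
  define N where "N = restricted_ring F \<phi> P"

  have inv_g: "inv\<^bsub>G\<^esub> g \<notin> \<phi> ` carrier F"
  proof
    assume "inv\<^bsub>G\<^esub> g \<in> \<phi> ` carrier F"
    then obtain f where f: "f \<in> carrier F" "inv\<^bsub>G\<^esub> g = \<phi> f"
      by blast
    then have "\<phi> (inv\<^bsub>F\<^esub> f) = g"
      using g(1) by (simp flip: f(2))
    then show False
      using g(2) f(1) F.inv_closed by blast
  qed
  \<comment> \<open>Of the degrees \<open>1\<close>, \<open>g\<close> and \<open>g\<^bsup>-1\<^esup>\<close> that occur in \<open>P\<close>, only the first is in the image of \<open>\<phi>\<close>.\<close>
  have comp_1: "component P (\<phi> \<one>\<^bsub>F\<^esub>) = i ` {r. coeff_x r = 0 \<and> coeff_y r = 0}"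
  proof -
    have "\<one>\<^bsub>G\<^esub> \<in> \<phi> ` carrier F"
      using F.one_closed \<phi>.hom_one by (metis imageI)
    then have "g \<noteq> \<one>\<^bsub>G\<^esub>" "inv\<^bsub>G\<^esub> g \<noteq> \<one>\<^bsub>G\<^esub>"
      using g inv_g by metis+
    then have "coarsening bidual_part G g \<one>\<^bsub>G\<^esub> = {r. coeff_x r = 0 \<and> coeff_y r = 0}"
      by (auto simp: coarsening_bidual[OF G g(1)])
    then show ?thesis
      by (simp add: P_def graded_copy_sel)
  qed
  have comp_f: "component P (\<phi> f) = {i 0}" if "f \<in> carrier F" "f \<noteq> \<one>\<^bsub>F\<^esub>" for f
  proof -
    have "inj_on \<phi> (carrier F)"
      using \<phi> by (simp add: mon_def)
    then have "\<phi> f \<noteq> \<one>\<^bsub>G\<^esub>"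
      using that F.one_closed \<phi>.hom_one by (metis inj_onD)
    moreover have "\<phi> f \<noteq> g" "\<phi> f \<noteq> inv\<^bsub>G\<^esub> g"
      using that g(2) inv_g by (metis imageI)+
    ultimately have "coarsening bidual_part G g (\<phi> f) = {0}"
      by (auto simp: coarsening_bidual[OF G g(1)] zero_bidual_def intro: bidual.expand)
    then show ?thesis
      by (simp add: P_def graded_copy_sel)
  qed
  have N_carrier: "carrier N = i ` {r. coeff_x r = 0 \<and> coeff_y r = 0}"
  proof -
    have "(\<Union>f \<in> carrier F. component P (\<phi> f)) = component P (\<phi> \<one>\<^bsub>F\<^esub>)"
      using F.one_closed comp_f comp_1 by (force simp: zero_bidual_def)
    moreover have "subgroup (component P (\<phi> \<one>\<^bsub>F\<^esub>)) (add_monoid P)"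
      using graded(1) by (auto simp: is_graded_ring_def additive_subgroup_def)
    ultimately have "carrier N = component P (\<phi> \<one>\<^bsub>F\<^esub>)"
      unfolding N_def restricted_ring_sel
      using P.add.generate_subgroup_incl[of "component P (\<phi> \<one>\<^bsub>F\<^esub>)" "component P (\<phi> \<one>\<^bsub>F\<^esub>)"]
      by (auto intro: generate.incl)
    then show ?thesis
      by (simp only: comp_1)
  qed

  define E where "E p q = copy_map i (bidual_subst p q)" for p q
  \<comment> \<open>\<open>k 1 1\<close> is the inclusion of \<open>N\<close> into \<open>Y\<close>, and \<open>k p q\<close> is its composite with \<open>E p q\<close>.\<close>
  define k where "k p q = restrict (E p q) (carrier N)" for p q
  have E: "E p q \<in> graded_hom G P P" for p q
    unfolding E_def P_def by (rule copy_map_graded_hom[OF i]) (simp_all only: bidual_subst_hom)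
  have E_apply: "E p q (i r) = i (bidual_subst p q r)" for p q r
    by (simp add: E_def copy_map_apply[OF i])
  have k_apply: "k p q (i r) = i (bidual_subst p q r)" if "coeff_x r = 0" "coeff_y r = 0" for p q r
    using that by (simp add: k_def E_apply N_carrier)
  have N_ops: "mult N = mult P" "add N = add P" "one N = one P"
    by (simp_all add: N_def restricted_ring_sel)
  have k: "k p q \<in> graded_hom F N Y" for p q
  proof -
    have "k p q \<in> ring_hom N Y"
      by (rule ring_hom_memI)
        (use i in \<open>auto simp: k_apply N_carrier N_ops P_def Y_def graded_copy_sel bidual_subst_hom
          coeff_bidual\<close>)
    moreover have "k p q ` component N f \<subseteq> component Y f" if f: "f \<in> carrier F" for f
    proof (cases "f = \<one>\<^bsub>F\<^esub>")
      case True
      have "coarsening bidual_part F \<one>\<^bsub>F\<^esub> \<one>\<^bsub>F\<^esub> = UNIV"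
        by (auto simp: coarsening_def)
      then have "component Y f = range i"
        by (simp add: Y_def graded_copy_sel True)
      moreover have "component N f = carrier N"
        unfolding True N_carrier by (simp only: N_def restricted_ring_sel(6) comp_1)
      ultimately show ?thesis
        by (auto simp: N_carrier k_apply)
    next
      case False
      have "component N f = {i 0}"
        unfolding N_def restricted_ring_sel(6) by (rule comp_f[OF f False])
      moreover have "k p q (i 0) = i 0"
        by (subst k_apply) (simp_all add: bidual_subst_def zero_bidual_def)
      ultimately show ?thesis
        using bidual.coarsening_0[of F "\<one>\<^bsub>F\<^esub>" f] by (simp add: Y_def graded_copy_sel)
    qed
    ultimately show ?thesis
      by (simp add: graded_hom_def k_def)
  qed
  have k_compose: "compose (carrier N) (k 1 1) (restrict (E p q) (carrier N)) = k p q" for p q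
  proof
    fix a
    show "compose (carrier N) (k 1 1) (restrict (E p q) (carrier N)) a = k p q a"
    proof (cases "a \<in> carrier N")
      case True
      then obtain r where r: "a = i r" "coeff_x r = 0" "coeff_y r = 0"
        by (auto simp: N_carrier)
      have "k 1 1 (E p q a) = i (bidual_subst 1 1 (bidual_subst p q r))"
        unfolding r(1) E_apply by (rule k_apply) (simp_all add: bidual_subst_def r)
      also have "\<dots> = k p q a"
        unfolding r(1) k_apply[OF r(2,3)] by (simp add: bidual_subst_def)
      finally show ?thesis
        using True by (simp add: compose_def)
    qed (simp add: compose_def k_def)
  qed
  have k_eq: "k p q = k p' q'" if "p * q = p' * q'" for p q p' q'
    unfolding k_def by (rule restrict_ext) (use that in \<open>auto simp: N_carrier E_apply bidual_subst_def\<close>)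

  define f where "f = \<Phi> P Y (k 1 1)"
  have on_restr: "on_obj (restriction F \<phi>) P = N"
    "on_arr (restriction F \<phi>) P P u = restrict u (carrier N)" for u
    by (simp_all add: restriction_def N_def)
  have bij: "bij_betw (\<Phi> P Y) (graded_hom F N Y) (graded_hom G P (on_obj D Y))"
  proof -
    have "bij_betw (\<Phi> P Y) (graded_hom F (on_obj (restriction F \<phi>) P) Y)
        (graded_hom G P (on_obj D Y))"
      using adj P Y unfolding adjunction_def Ann_sel(2) by blast
    then show ?thesis
      by (simp only: on_restr)
  qed
  have f: "f \<in> graded_hom G P (on_obj D Y)"
    unfolding f_def using bij_betwE[OF bij] k by blast
  have nat: "\<Phi> P Y (k p q) = compose (carrier P) f (E p q)" for p q
  proof -
    have "k 1 1 \<in> graded_hom F (on_obj (restriction F \<phi>) P) Y"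
      unfolding on_restr by (rule k)
    then have "\<Phi> P Y (cmp (Ann TYPE('a) F) (on_obj (restriction F \<phi>) P)
          (on_obj (restriction F \<phi>) P) Y
          (k 1 1) (on_arr (restriction F \<phi>) P P (E p q)))
        = cmp (Ann TYPE('a) G) P P (on_obj D Y) (\<Phi> P Y (k 1 1)) (E p q)"
      using adj P Y E[of p q] unfolding adjunction_def Ann_sel(2) by blast
    then show ?thesis
      by (simp only: on_restr Ann_sel(3) k_compose f_def)
  qed
  have f_subst: "f (i (bidual_subst 1 0 r)) = f (i (bidual_subst 0 0 r))"
    "f (i (bidual_subst 0 1 r)) = f (i (bidual_subst 0 0 r))" for r
  proof -
    have "compose (carrier P) f (E p q) (i r) = f (i (bidual_subst p q r))" for p q
      by (simp add: compose_def P_def graded_copy_sel E_apply)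
    then show "f (i (bidual_subst 1 0 r)) = f (i (bidual_subst 0 0 r))"
      "f (i (bidual_subst 0 1 r)) = f (i (bidual_subst 0 0 r))"
      using nat k_eq[of 1 0 0 0] k_eq[of 0 1 0 0] by (metis mult_zero_left mult_zero_right)+
  qed
  have DY: "cring (on_obj D Y)"
    using D Y by (auto simp: is_functor_def Ann_sel is_graded_ring_def)
  interpret DY: cring "on_obj D Y" by (rule DY)
  interpret f: ring_hom_ring P "on_obj D Y" f
    by (rule ring_hom_ringI2[OF P.ring_axioms DY.ring_axioms])
      (use f in \<open>simp add: graded_hom_def\<close>)
  have mem: "i r \<in> carrier P" for r
    by (simp add: P_def graded_copy_sel)
  \<comment> \<open>\<open>E 0 1\<close> fixes \<open>y\<close>, and \<open>E 0 0\<close> sends it to \<open>0\<close>.\<close>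
  have f_y: "f (i (Bidual 0 0 1 0)) = \<zero>\<^bsub>on_obj D Y\<^esub>"
    using f_subst(2)[of "Bidual 0 0 1 0"] f.hom_zero
    by (simp add: bidual_subst_def P_def graded_copy_sel zero_bidual_def)
  have "f (i (bidual_subst 1 0 r)) = f (i r)" for r
  proof -
    \<comment> \<open>Modulo the ideal \<open>(y)\<close>, setting \<open>y\<close> to \<open>0\<close> changes nothing.\<close>
    have "i r = i (bidual_subst 1 0 r) \<oplus>\<^bsub>P\<^esub>
        (i (Bidual 0 0 1 0) \<otimes>\<^bsub>P\<^esub> i (Bidual (coeff_y r) (coeff_xy r) 0 0))"
      using i by (cases r) (simp add: P_def graded_copy_sel bidual_subst_def bidual_defs)
    then show ?thesis
      using f_y mem by simp
  qed
  then have "compose (carrier P) f (E 1 0) = compose (carrier P) f (E 1 1)"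
    by (intro ext) (auto simp: compose_def P_def graded_copy_sel E_apply bidual_subst_def)
  then have "k 1 0 = k 1 1"
    using inj_onD[OF bij_betw_imp_inj_on[OF bij]] nat k by metis
  then have "k 1 0 (i (Bidual 0 0 0 1)) = k 1 1 (i (Bidual 0 0 0 1))"
    by simp
  then show False
    using i by (simp add: k_def N_carrier E_apply bidual_subst_def inj_eq)
qed

section \<open>Monomorphisms that are not surjective\<close>

theorem mainTheorem2:
  fixes F :: "('f, 'x) monoid_scheme" and G :: "('g, 'y) monoid_scheme" and \<phi> :: "'f \<Rightarrow> 'g"
  assumes "uncountable (UNIV :: 'a set)"
    and "comm_group F" and "comm_group G"
    and "\<phi> \<in> mon F G" and "\<phi> \<notin> iso F G"
  shows "\<not> has_left_adjoint (Ann TYPE('a) G) (Ann TYPE('a) F) (corestriction F G \<phi>)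
    \<and> \<not> has_right_adjoint (Ann TYPE('a) G) (Ann TYPE('a) F) (restriction F \<phi>)"
proof -
  have hom: "\<phi> \<in> hom F G"
    using assms(4) by (simp add: mon_def)
  then obtain g where g: "g \<in> carrier G" "g \<notin> \<phi> ` carrier F"
    using assms(4,5) by (auto simp: mon_def iso_def bij_betw_def hom_def)
  have "group F" "group G"
    using assms(2,3) by (simp_all add: comm_group.axioms(2))
  then show ?thesis
    using corestriction_no_left_adjoint[OF assms(1) _ _ hom g]
      restriction_no_right_adjoint[OF assms(1) _ _ assms(4) g] by simp
qed

end
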